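(* Consider a directed unweighted network without self-links on the finite node set $N$, with adjacency matrix $\mathbf{G}$ and link set $\mathcal{G}$. Consider a structural intervention that removes the links in a set $\mathcal{L}_{-}\subseteq\mathcal{G}$ and adds the links in a set $\mathcal{L}_{+}\subseteq\mathcal{G}^{C}$. Let $\mathbf{L}_{-}$ and $\mathbf{L}_{+}$ be the $n\times n$ zero-one matrices whose $(i,j)$ entry is $1$ exactly when $(i,j)\in\mathcal{L}_{-}$, respectively $(i,j)\in\mathcal{L}_{+}$. Then the generating function matrix $\mathbf{M}(\mathcal{L}_{-},\mathcal{L}_{+})$ for walks in the post-intervention network (the network with adjacency matrix $\mathbf{G}-\mathbf{L}_{-}+\mathbf{L}_{+}$) satisfies $$\mathbf{M}(\mathcal{L}_{-},\mathcal{L}_{+})=\mathbf{M}+x\,\mathbf{M}(\mathbf{L}_{+}-\mathbf{L}_{-})\big(\mathbf{I}-x\,\mathbf{M}(\mathbf{L}_{+}-\mathbf{L}_{-})\big)^{-1}\mathbf{M}$$ as an identity of matrices over the formal power series ring in $x$.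
   Context: $N=\{1,\dots,n\}$; $\mathbf{G}=(g_{ij})$ with $g_{ij}\in\{0,1\}$, $g_{ii}=0$, and $\mathcal{G}=\{(i,j):g_{ij}=1\}$. $\mathcal{G}^{C}$ is the complement of $\mathcal{G}$, i.e. the set of ordered pairs of distinct nodes not in $\mathcal{G}$ (networks have no self-links). A walk in a network is a node sequence $(i_0,\dots,i_K)$, $K\ge0$, in which each consecutive pair $(i_k,i_{k+1})$ is a link of that network; its length is $K$ (length-zero walks are allowed). The generating function matrix of a network is the $n\times n$ matrix whose $(i,j)$ entry is the formal power series $\sum_{t\ge0}c_{ij}(t)x^t$, where $c_{ij}(t)$ is the number of walks of length $t$ from $i$ to $j$ in that network. $\mathbf{M}$ is the generating function matrix of the original network $\mathbf{G}$. $\mathbf{I}$ is the identity matrix and inverses are taken in the ring of matrices over formal power series in $x$. *)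

theory Defs
  imports "HOL-Analysis.Analysis" "HOL-Computational_Algebra.Formal_Power_Series"
begin

text \<open>Nodes are the elements of a finite type \<open>'n\<close>; a network is given by its
  adjacency matrix.\<close>

definition network :: "real ^ 'n ^ 'n \<Rightarrow> bool" where
  "network G \<longleftrightarrow> (\<forall>i j. G $ i $ j \<in> {0, 1}) \<and> (\<forall>i. G $ i $ i = 0)"

definition links :: "real ^ 'n ^ 'n \<Rightarrow> ('n \<times> 'n) set" where
  "links G = {(i, j). G $ i $ j = 1}"

definition link_complement :: "real ^ 'n ^ 'n \<Rightarrow> ('n \<times> 'n) set" where
  "link_complement G = {(i, j). i \<noteq> j \<and> (i, j) \<notin> links G}"

definition indicator_matrix :: "('n \<times> 'n) set \<Rightarrow> real ^ 'n ^ 'n" where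
  "indicator_matrix L = (\<chi> i j. if (i, j) \<in> L then 1 else 0)"

definition walk :: "real ^ 'n ^ 'n \<Rightarrow> 'n list \<Rightarrow> bool" where
  "walk G p \<longleftrightarrow> p \<noteq> [] \<and> successively (\<lambda>u v. (u, v) \<in> links G) p"

text \<open>A walk of length \<open>t\<close> visits \<open>t + 1\<close> nodes.\<close>

definition walks :: "real ^ 'n ^ 'n \<Rightarrow> 'n \<Rightarrow> 'n \<Rightarrow> nat \<Rightarrow> 'n list set" where
  "walks G i j t = {p. walk G p \<and> length p = t + 1 \<and> hd p = i \<and> last p = j}"

definition gen_fun_matrix :: "real ^ 'n ^ 'n \<Rightarrow> real fps ^ 'n ^ 'n" where
  "gen_fun_matrix G = (\<chi> i j. Abs_fps (\<lambda>t. real (card (walks G i j t))))"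

definition const_matrix :: "real ^ 'n ^ 'n \<Rightarrow> real fps ^ 'n ^ 'n" where
  "const_matrix A = map_matrix fps_const A"

text \<open>The library's \<open>*s\<close> scales vectors only, hence this entrywise
  multiplication of a matrix by the indeterminate.\<close>

definition X_mult :: "real fps ^ 'n ^ 'n \<Rightarrow> real fps ^ 'n ^ 'n" where
  "X_mult A = map_matrix (\<lambda>a. fps_X * a) A"

end

theory Submission
  imports Defs
begin

text \<open>Decomposing walks by their first step gives \<open>M = (I - xG)\<^sup>-\<^sup>1\<close> for every 0-1 matrix \<open>G\<close>.
  If \<open>G' = G + D\<close>, then \<open>I - xMD = M(I - xG) - xMD = M(I - xG')\<close>, which has the inverse
  \<open>M'(I - xG)\<close>. Hence \<open>xMD(I - xMD)\<^sup>-\<^sup>1M = xMDM' = (I - M(I - xG'))M' = M' - M\<close>.\<close>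

lemma walks_0: "walks A i j 0 = (if i = j then {[i]} else {})"
  by (auto simp: walks_def walk_def length_Suc_conv)

lemma walks_Suc:
  "walks A i j (Suc t) = (\<Union>k\<in>{k. (i, k) \<in> links A}. (#) i ` walks A k j t)"
proof (intro set_eqI iffI)
  fix p assume p: "p \<in> walks A i j (Suc t)"
  then obtain k q where q: "p = i # k # q"
    by (auto simp: walks_def length_Suc_conv)
  with p have "(i, k) \<in> links A" "k # q \<in> walks A k j t"
    by (auto simp: walks_def walk_def)
  with q show "p \<in> (\<Union>k\<in>{k. (i, k) \<in> links A}. (#) i ` walks A k j t)"
    by blast
next
  fix p assume "p \<in> (\<Union>k\<in>{k. (i, k) \<in> links A}. (#) i ` walks A k j t)"
  then show "p \<in> walks A i j (Suc t)"
    by (auto simp: walks_def walk_def successively_Cons)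
qed

lemma finite_walks: "finite (walks A i j t)"
proof (rule finite_subset)
  show "walks A i j t \<subseteq> {p. set p \<subseteq> UNIV \<and> length p = t + 1}"
    by (auto simp: walks_def)
qed (rule finite_lists_length_eq, simp)

lemma card_walks_Suc:
  "card (walks A i j (Suc t)) = (\<Sum>k | (i, k) \<in> links A. card (walks A k j t))"
proof -
  have "card (walks A i j (Suc t))
      = (\<Sum>k | (i, k) \<in> links A. card ((#) i ` walks A k j t))"
    unfolding walks_Suc
    \<comment> \<open>The pieces are disjoint because the second node of a walk in the piece for
      \<open>k\<close> is \<open>k\<close> itself.\<close>
    by (rule card_UN_disjoint, simp, blast intro: finite_imageI finite_walks)
      (auto simp: walks_def)
  also have "\<dots> = (\<Sum>k | (i, k) \<in> links A. card (walks A k j t))"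
    by (simp add: card_image)
  finally show ?thesis .
qed

text \<open>These are the coefficient matrices of \<open>gen_fun_matrix A\<close>; for a 0-1 matrix
  they turn out to be the powers of \<open>A\<close>.\<close>

definition walk_count :: "real ^ 'n ^ 'n \<Rightarrow> nat \<Rightarrow> real ^ 'n ^ 'n" where
  "walk_count A t = (\<chi> i j. real (card (walks A i j t)))"

lemma walk_count_0: "walk_count A 0 = mat 1"
  by (simp add: walk_count_def walks_0 mat_def vec_eq_iff)

lemma walk_count_Suc:
  fixes A :: "real ^ 'n ^ 'n"
  assumes "\<And>i j. A $ i $ j \<in> {0, 1}"
  shows "walk_count A (Suc t) = A ** walk_count A t"
proof -
  have "real (card (walks A i j (Suc t))) = (\<Sum>k\<in>UNIV. A $ i $ k * real (card (walks A k j t)))"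
    for i j
  proof -
    have "A $ i $ k = (if (i, k) \<in> links A then 1 else 0)" for k
      using assms[of i k] by (auto simp: links_def)
    then have "(\<Sum>k\<in>UNIV. A $ i $ k * real (card (walks A k j t)))
        = (\<Sum>k\<in>UNIV. if (i, k) \<in> links A then real (card (walks A k j t)) else 0)"
      by (intro sum.cong) auto
    then show ?thesis
      by (simp add: card_walks_Suc sum.If_cases)
  qed
  then show ?thesis
    by (simp add: walk_count_def matrix_matrix_mult_def vec_eq_iff)
qed

text \<open>No second decomposition of walks is needed: the first-step recursion and associativity
  show by induction that \<open>A\<close> commutes with the counts.\<close>

lemma walk_count_Suc':
  fixes A :: "real ^ 'n ^ 'n"
  assumes "\<And>i j. A $ i $ j \<in> {0, 1}"
  shows "walk_count A (Suc t) = walk_count A t ** A"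
proof (induction t)
  case (Suc t)
  then show ?case
    by (metis walk_count_Suc[OF assms] matrix_mul_assoc)
qed (simp add: walk_count_Suc[OF assms] walk_count_0)

lemma matrix_diff_ldistrib: "A ** (B - C) = A ** B - A ** (C :: 'a::ring_1 ^ 'n ^ 'm)"
  by (simp add: matrix_matrix_mult_def vec_eq_iff right_diff_distrib sum_subtractf)

lemma matrix_diff_rdistrib: "(A - B) ** C = A ** C - B ** (C :: 'a::ring_1 ^ 'n ^ 'm)"
  by (simp add: matrix_matrix_mult_def vec_eq_iff left_diff_distrib sum_subtractf)

text \<open>As \<open>matrix_inv\<close> is a Hilbert choice, exhibiting an inverse is not enough.
  Uniqueness comes from C = (BA)C = B(AC) = B, which makes sense over any semiring, in particular
  over power series.\<close>

lemma matrix_inv_eqI: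
  fixes A :: "'a::semiring_1 ^ 'n ^ 'm" and B :: "'a ^ 'm ^ 'n"
  assumes "A ** B = mat 1" "B ** A = mat 1"
  shows "matrix_inv A = B"
  unfolding matrix_inv_def
proof (rule some_equality)
  fix C assume "A ** C = mat 1 \<and> C ** A = mat 1"
  then show "C = B"
    by (metis assms matrix_mul_assoc matrix_mul_lid matrix_mul_rid)
qed (simp add: assms)

lemma matrix_fps_eqI:
  fixes P Q :: "'a::zero fps ^ 'n ^ 'm"
  assumes "\<And>i j t. fps_nth (P $ i $ j) t = fps_nth (Q $ i $ j) t"
  shows "P = Q"
  using assms by (simp add: vec_eq_iff fps_eq_iff)

lemma gen_fun_matrix_nth:
  "fps_nth (gen_fun_matrix A $ i $ j) t = walk_count A t $ i $ j"
  by (simp add: gen_fun_matrix_def walk_count_def)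

lemma X_mult_matrix_mult_left: "X_mult (P ** Q) = X_mult P ** Q"
  by (simp add: X_mult_def map_matrix_def matrix_matrix_mult_def vec_eq_iff
      sum_distrib_left mult.assoc)

text \<open>Here x has to move past the entries of \<open>P\<close>, which is possible because it is
  central.\<close>

lemma X_mult_matrix_mult_right: "X_mult (P ** Q) = P ** X_mult Q"
  by (simp add: X_mult_def map_matrix_def matrix_matrix_mult_def vec_eq_iff
      sum_distrib_left mult.left_commute)

lemma X_mult_const_matrix_add:
  "X_mult (const_matrix (A + B)) = X_mult (const_matrix A) + X_mult (const_matrix B)"
  by (simp add: X_mult_def const_matrix_def map_matrix_def vec_eq_iff distrib_left
      flip: fps_const_add)

text \<open>Compare coefficients: the constant term is the identity, and multiplication by x shifts
  the recursion for the counts to degree t + 1.\<close>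

lemma gen_fun_matrix_first_step:
  fixes A :: "real ^ 'n ^ 'n"
  assumes "\<And>i j. A $ i $ j \<in> {0, 1}"
  shows "(mat 1 - X_mult (const_matrix A)) ** gen_fun_matrix A = mat 1"
proof -
  have "gen_fun_matrix A = mat 1 + X_mult (const_matrix A ** gen_fun_matrix A)"
  proof (rule matrix_fps_eqI)
    fix i j t
    show "fps_nth (gen_fun_matrix A $ i $ j) t
        = fps_nth ((mat 1 + X_mult (const_matrix A ** gen_fun_matrix A)) $ i $ j) t"
      by (cases t) (simp_all add: gen_fun_matrix_nth walk_count_0 walk_count_Suc[OF assms]
          X_mult_def const_matrix_def map_matrix_def matrix_matrix_mult_def mat_def fps_sum_nth)
  qed
  then show ?thesis
    by (simp add: matrix_diff_rdistrib X_mult_matrix_mult_left diff_eq_eq)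
qed

text \<open>This supplies the other side of the inverse. Both sides are used, for the old and the
  new network, to invert I - xMD.\<close>

lemma gen_fun_matrix_last_step:
  fixes A :: "real ^ 'n ^ 'n"
  assumes "\<And>i j. A $ i $ j \<in> {0, 1}"
  shows "gen_fun_matrix A ** (mat 1 - X_mult (const_matrix A)) = mat 1"
proof -
  have "gen_fun_matrix A = mat 1 + X_mult (gen_fun_matrix A ** const_matrix A)"
  proof (rule matrix_fps_eqI)
    fix i j t
    show "fps_nth (gen_fun_matrix A $ i $ j) t
        = fps_nth ((mat 1 + X_mult (gen_fun_matrix A ** const_matrix A)) $ i $ j) t"
      by (cases t) (simp_all add: gen_fun_matrix_nth walk_count_0 walk_count_Suc'[OF assms]
          X_mult_def const_matrix_def map_matrix_def matrix_matrix_mult_def mat_def fps_sum_nth)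
  qed
  then show ?thesis
    by (simp add: matrix_diff_ldistrib X_mult_matrix_mult_right diff_eq_eq)
qed

theorem proposition2:
  fixes G :: "real ^ 'n ^ 'n"
    and L_minus L_plus :: "('n \<times> 'n) set"
  assumes "network G"
    and "L_minus \<subseteq> links G"
    and "L_plus \<subseteq> link_complement G"
  defines "M \<equiv> gen_fun_matrix G"
    and "M' \<equiv> gen_fun_matrix (G - indicator_matrix L_minus + indicator_matrix L_plus)"
    and "D \<equiv> const_matrix (indicator_matrix L_plus - indicator_matrix L_minus)"
  shows "invertible (mat 1 - X_mult (M ** D)) \<and>
    M' = M + X_mult (M ** D ** matrix_inv (mat 1 - X_mult (M ** D)) ** M)"
proof -
  define G' where "G' = G - indicator_matrix L_minus + indicator_matrix L_plus"
  define R where "R = mat 1 - X_mult (const_matrix G)"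
  define R' where "R' = mat 1 - X_mult (const_matrix G')"
  have G01: "G $ i $ j \<in> {0, 1}" for i j
    using assms(1) by (auto simp: network_def)
  \<comment> \<open>Links are removed only where the entry is 1 and added only where it is 0, so no
    entry becomes -1 or 2.\<close>
  have G'01: "G' $ i $ j \<in> {0, 1}" for i j
    using G01[of i j] assms(2,3)
    by (auto simp: G'_def indicator_matrix_def links_def link_complement_def)
  have RM: "R ** M = mat 1" "M ** R = mat 1"
    unfolding R_def M_def
    by (rule gen_fun_matrix_first_step[OF G01] gen_fun_matrix_last_step[OF G01])+
  have RM': "R' ** M' = mat 1" "M' ** R' = mat 1"
    unfolding R'_def M'_def G'_def[symmetric]
    by (rule gen_fun_matrix_first_step[OF G'01] gen_fun_matrix_last_step[OF G'01])+
  have "G' = G + (indicator_matrix L_plus - indicator_matrix L_minus)"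
    by (simp add: G'_def)
  then have "R' = R - X_mult D"
    by (simp add: R_def R'_def D_def X_mult_const_matrix_add)
  then have K: "mat 1 - X_mult (M ** D) = M ** R'"
    by (simp add: matrix_diff_ldistrib RM X_mult_matrix_mult_right)
  \<comment> \<open>The inner pair cancels first, R'M' in one product and RM in the other; then the
    outer pair does.\<close>
  have inv: "(M ** R') ** (M' ** R) = mat 1" "(M' ** R) ** (M ** R') = mat 1"
    by (metis RM RM' matrix_mul_assoc matrix_mul_rid)+
  then have K_inv: "matrix_inv (M ** R') = M' ** R"
    by (rule matrix_inv_eqI)
  \<comment> \<open>The factor \<open>R\<close> of the inverse meets the trailing \<open>M\<close>
    and cancels, so that only xMDM' is left.\<close>
  have "X_mult (M ** D ** matrix_inv (M ** R') ** M) = X_mult (M ** D) ** (M' ** (R ** M))"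
    by (simp add: K_inv X_mult_matrix_mult_left matrix_mul_assoc)
  also have "\<dots> = (mat 1 - M ** R') ** M'"
    by (simp add: RM flip: K)
  also have "\<dots> = M' - M"
    by (simp add: matrix_diff_rdistrib RM' flip: matrix_mul_assoc)
  finally show ?thesis
    using inv unfolding K invertible_def by auto
qed

end
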